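(* Let $X$ be a real Banach space and let $A,B_1,B_2,B_3$ be closed operators on $X$, each satisfying (with $T$ standing for the operator) the condition: there is a constant $M$ such that $(0,\infty)\subset\rho(T)$ and $\|\lambda R(\lambda,T)\|_{L(X)}\le M$ for all $\lambda>0$. Suppose moreover that $$[B_i,B_j]=0\ (1\le i,j\le 3),\qquad [A,B_1]=-B_2,\qquad [A,B_2]=-B_1,\qquad [A,B_3]=0.$$ Set $\mathcal{D}(B)=\bigcap_{i=1}^3\mathcal{D}(B_i)$ with norm $\|x\|_{\mathcal{D}(B)}=\|x\|+\sum_{i=1}^3\|B_ix\|$, and $D=\mathcal{D}(A)\cap\mathcal{D}(B)$ with norm $\|x\|_D=\|x\|+\|Ax\|+\sum_{i=1}^3\|B_ix\|$. Then for $\theta\in(0,1)$, $$(X,D)_{\theta,2}=\mathcal{D}_A(\theta,2)\cap\mathcal{D}_B(\theta,2).$$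
   Context: For an operator $T$ with domain $\mathcal{D}(T)\subset X$: $\rho(T)$ is its resolvent set, $R(\lambda,T)=(\lambda I-T)^{-1}$, $\|\cdot\|_{L(X)}$ is the operator norm, and $\mathcal{D}(T)$ carries the graph norm $\|x\|_{\mathcal{D}(T)}=\|x\|+\|Tx\|$. The commutator is $[S,T]=ST-TS$. Real interpolation: for an interpolation couple $(X,Y)$, $\theta\in(0,1)$, $p\in[1,\infty]$, $$(X,Y)_{\theta,p}=\Big\{x\in X+Y:\ \|x\|_{\theta,p}=\big\|t^{-\theta}K(t,x)\big\|_{L^p_*(0,\infty)}<\infty\Big\},\qquad K(t,x)=\inf_{x=a+b,\ a\in X,\ b\in Y}(\|a\|_X+t\|b\|_Y),$$ where $L^p_*(0,\infty)$ is the Lebesgue space with respect to the measure $dt/t$. Notation: $\mathcal{D}_A(\theta,2)=(X,\mathcal{D}(A))_{\theta,2}$ and $\mathcal{D}_B(\theta,2)=(X,\mathcal{D}(B))_{\theta,2}$.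
   Formalization: Each identity [S,T]=C is read as: both sides agree where both are defined, and for all large λ, R(λ,S) maps D(T)∩D(C) into D([S,T])∩D(C); with agreement on the common domain alone the claim is false. *)

theory Defs
  imports "HOL-Analysis.Analysis"
begin

text \<open>An operator is a domain together with a function whose values outside the
  domain are irrelevant. The scalar field is \<^typ>\<open>real\<close> throughout, including for the
  resolvent set.\<close>

record 'a opr =
  op_dom :: "'a set"
  op_app :: "'a \<Rightarrow> 'a"

definition linear_opr :: "'a::real_vector opr \<Rightarrow> bool" where
  "linear_opr T \<longleftrightarrow> subspace (op_dom T) \<and>
     (\<forall>x\<in>op_dom T. \<forall>y\<in>op_dom T. op_app T (x + y) = op_app T x + op_app T y) \<and>
     (\<forall>x\<in>op_dom T. \<forall>c. op_app T (c *\<^sub>R x) = c *\<^sub>R op_app T x)"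

definition closed_opr :: "'a::real_normed_vector opr \<Rightarrow> bool" where
  "closed_opr T \<longleftrightarrow> linear_opr T \<and> closed {(x, op_app T x) | x. x \<in> op_dom T}"

definition resolvent :: "real \<Rightarrow> 'a::real_vector opr \<Rightarrow> 'a \<Rightarrow> 'a" where
  "resolvent l T = inv_into (op_dom T) (\<lambda>x. l *\<^sub>R x - op_app T x)"

definition resolvent_set :: "'a::real_normed_vector opr \<Rightarrow> real set" where
  "resolvent_set T = {l. bij_betw (\<lambda>x. l *\<^sub>R x - op_app T x) (op_dom T) UNIV \<and>
                         bounded_linear (resolvent l T)}"

definition resolvent_bounded :: "'a::real_normed_vector opr \<Rightarrow> bool" where
  "resolvent_bounded T \<longleftrightarrow>
     (\<exists>M. {0<..} \<subseteq> resolvent_set T \<and>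
          (\<forall>l>0. onorm (\<lambda>x. l *\<^sub>R resolvent l T x) \<le> M))"

definition zero_opr :: "'a::zero opr" where
  "zero_opr = \<lparr>op_dom = UNIV, op_app = (\<lambda>x. 0)\<rparr>"

definition neg_opr :: "'a::uminus opr \<Rightarrow> 'a opr" where
  "neg_opr T = \<lparr>op_dom = op_dom T, op_app = (\<lambda>x. - op_app T x)\<rparr>"

definition comp_opr :: "'a opr \<Rightarrow> 'a opr \<Rightarrow> 'a opr" where
  "comp_opr S T = \<lparr>op_dom = {x \<in> op_dom T. op_app T x \<in> op_dom S},
                   op_app = (\<lambda>x. op_app S (op_app T x))\<rparr>"

definition diff_opr :: "'a::minus opr \<Rightarrow> 'a opr \<Rightarrow> 'a opr" where
  "diff_opr S T = \<lparr>op_dom = op_dom S \<inter> op_dom T,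
                   op_app = (\<lambda>x. op_app S x - op_app T x)\<rparr>"

definition commutator :: "'a::minus opr \<Rightarrow> 'a opr \<Rightarrow> 'a opr" where
  "commutator S T = diff_opr (comp_opr S T) (comp_opr T S)"

text \<open>Meaning of an identity $[S,T] = C$ between unbounded operators. Literal equality,
  domains included, is not what is meant: $[T,T] = 0$ would force $T$ to be everywhere
  defined. Mere agreement on the common domain is not enough either, as
  the domain of $[S,T]$ may be $\{0\}$ for non-commuting $S$, $T$. So the two sides agree
  wherever both are defined, and for all large $\lambda$ the resolvent $R(\lambda,S)$ maps
  $D(T) \cap D(C)$ into the set where both are defined. On that domain this is the resolvent
  identity $T R(\lambda,S) = R(\lambda,S) T + R(\lambda,S) (-C) R(\lambda,S)$; when
  $C = 0$ and both resolvent sets contain a half-line it says exactly that the resolvents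
  commute, the usual meaning of commutation for unbounded operators. Only large $\lambda$
  can be used: if $[A,C] = -C$ then formally $C R(\lambda+1,A) = R(\lambda,A) C$, so
  invariance of the domain of $C$ under $R(\mu,A)$ can fail for $\mu \le 1$.\<close>

definition commutator_is :: "'a::real_normed_vector opr \<Rightarrow> 'a opr \<Rightarrow> 'a opr \<Rightarrow> bool" where
  "commutator_is S T C \<longleftrightarrow>
     (\<forall>x \<in> op_dom (commutator S T) \<inter> op_dom C. op_app (commutator S T) x = op_app C x) \<and>
     (\<forall>\<^sub>F l in at_top. l \<in> resolvent_set S \<and>
        resolvent l S ` (op_dom T \<inter> op_dom C) \<subseteq> op_dom (commutator S T) \<inter> op_dom C)"

text \<open>A normed space inside the ambient vector space: its carrier and its norm, the latter
  being relevant on the carrier only.\<close>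

type_synonym 'a nspace = "'a set \<times> ('a \<Rightarrow> real)"

definition whole_space :: "'a::real_normed_vector nspace" where
  "whole_space = (UNIV, norm)"

definition domain_space :: "'a::real_normed_vector opr \<Rightarrow> 'a nspace" where
  "domain_space T = (op_dom T, \<lambda>x. norm x + norm (op_app T x))"

definition family_domain_space :: "(nat \<Rightarrow> 'a::real_normed_vector opr) \<Rightarrow> 'a nspace" where
  "family_domain_space B =
     (\<Inter>i\<in>{1..3}. op_dom (B i), \<lambda>x. norm x + (\<Sum>i=1..3. norm (op_app (B i) x)))"

definition joint_domain_space ::
    "'a::real_normed_vector opr \<Rightarrow> (nat \<Rightarrow> 'a opr) \<Rightarrow> 'a nspace" where
  "joint_domain_space A B =
     (op_dom A \<inter> (\<Inter>i\<in>{1..3}. op_dom (B i)),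
      \<lambda>x. norm x + norm (op_app A x) + (\<Sum>i=1..3. norm (op_app (B i) x)))"

definition K_functional ::
    "'a::ab_group_add nspace \<Rightarrow> 'a nspace \<Rightarrow> real \<Rightarrow> 'a \<Rightarrow> real" where
  "K_functional X Y t x =
     Inf {snd X a + t * snd Y b | a b. a \<in> fst X \<and> b \<in> fst Y \<and> x = a + b}"

text \<open>The \<open>p\<close>-th power of the norm of $t^{-\theta} K(t,x)$ in $L^p((0,\infty), dt/t)$,
  for finite \<open>p\<close>.\<close>

definition interp_integral ::
    "'a::ab_group_add nspace \<Rightarrow> 'a nspace \<Rightarrow> real \<Rightarrow> real \<Rightarrow> 'a \<Rightarrow> ennreal" where
  "interp_integral X Y \<theta> p x =
     (\<integral>\<^sup>+ t\<in>{0<..}. ennreal ((t powr (- \<theta>) * K_functional X Y t x) powr p / t) \<partial>lborel)"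

definition real_interp ::
    "'a::ab_group_add nspace \<Rightarrow> 'a nspace \<Rightarrow> real \<Rightarrow> real \<Rightarrow> 'a nspace" where
  "real_interp X Y \<theta> p =
     ({x. (\<exists>a\<in>fst X. \<exists>b\<in>fst Y. x = a + b) \<and> interp_integral X Y \<theta> p x < \<infinity>},
      \<lambda>x. enn2real (interp_integral X Y \<theta> p x) powr (1 / p))"

definition inter_space :: "'a nspace \<Rightarrow> 'a nspace \<Rightarrow> 'a nspace" where
  "inter_space E F = (fst E \<inter> fst F, \<lambda>x. snd E x + snd F x)"

text \<open>Equality of interpolation spaces: same elements, equivalent norms.\<close>

definition same_space :: "'a nspace \<Rightarrow> 'a nspace \<Rightarrow> bool" where
  "same_space E F \<longleftrightarrow> fst E = fst F \<and>
     (\<exists>c>0. \<exists>C>0. \<forall>x\<in>fst E. c * snd E x \<le> snd F x \<and> snd F x \<le> C * snd E x)"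

end

theory Submission
  imports Defs
begin

text \<open>
  The idea is to compare K-functionals pointwise: there is a constant \<open>C\<close> with
  \<open>K(t,x; X,D) \<le> C (K(t,x; X,D(A)) + K(t,x; X,D(B)))\<close> for all \<open>t > 0\<close>. Integrating this, and
  the reverse comparisons coming from the embeddings of \<open>D\<close> into \<open>D(A)\<close> and \<open>D(B)\<close>, yields the theorem
  (\<open>real_interp_eq_inter_space\<close>).

  To bound \<open>K(t,x; X,D)\<close> for small \<open>t\<close>, put \<open>l = 1 / t\<close> and \<open>J\<^sub>T = l R(l,T)\<close>, and approximate \<open>x\<close> by
  \<open>u = J\<^sub>A y\<close>, where \<open>y\<close> is the product of the \<open>J\<close>'s of the three \<open>B\<^sub>i\<close> applied to \<open>x\<close>. For one operator,
  \<open>T J\<^sub>T w = l (J\<^sub>T w - w)\<close>, and the error \<open>norm (J\<^sub>T x - x)\<close> is at most a constant times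
  \<open>K(t,x; X,D(T))\<close> (\<open>yosida_error_le_K\<close>). Thus both the distance from \<open>x\<close> to \<open>J\<^sub>T x\<close> and
  \<open>t * norm (T (J\<^sub>T x))\<close> are controlled by \<open>K\<close>.

  The remaining question is whether the operators \<open>J\<close> respect the domains of the other operators.
  Among the commuting \<open>B\<^sub>i\<close> this is clear, so \<open>y\<close> is good for all three at once
  (\<open>simultaneous_yosida_approximation\<close>). The operator \<open>J\<^sub>A\<close> does not commute with \<open>B\<^sub>1\<close> and \<open>B\<^sub>2\<close>,
  but each commutator is, up to sign, the other operator, so it is of lower order: the error terms carry a
  factor \<open>1 / l\<close> and are absorbed when \<open>l\<close> is large (\<open>yosida_bounded_on_joint_domain\<close>).
  For \<open>t\<close> bounded away from \<open>0\<close> all the K-functionals are comparable with \<open>norm x\<close>.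
\<close>

section \<open>Resolvents and Yosida approximations\<close>

lemma resolvent_in_dom:
  assumes "l \<in> resolvent_set T"
  shows "resolvent l T y \<in> op_dom T"
  using assms unfolding resolvent_set_def resolvent_def bij_betw_def
  by (auto intro: inv_into_into)

lemma resolvent_right_inverse:
  assumes "l \<in> resolvent_set T"
  shows "l *\<^sub>R resolvent l T y - op_app T (resolvent l T y) = y"
  using assms unfolding resolvent_set_def resolvent_def bij_betw_def
  by (auto intro: f_inv_into_f[where f = "\<lambda>x. l *\<^sub>R x - op_app T x"])

lemma resolvent_left_inverse:
  assumes "l \<in> resolvent_set T" and "x \<in> op_dom T"
  shows "resolvent l T (l *\<^sub>R x - op_app T x) = x"
  using assms unfolding resolvent_set_def resolvent_def bij_betw_def
  by (auto intro: inv_into_f_f[where f = "\<lambda>x. l *\<^sub>R x - op_app T x"])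

lemma op_app_resolvent:
  assumes "l \<in> resolvent_set T"
  shows "op_app T (resolvent l T y) = l *\<^sub>R resolvent l T y - y"
  using resolvent_right_inverse[OF assms, of y] by (simp add: algebra_simps)

lemma linear_resolvent:
  assumes "l \<in> resolvent_set T"
  shows "linear (resolvent l T)"
  using assms by (simp add: resolvent_set_def bounded_linear.linear)

definition resolvent_bound :: "real \<Rightarrow> 'a::real_normed_vector opr \<Rightarrow> bool" where
  "resolvent_bound M T \<longleftrightarrow>
     (\<forall>l>0. l \<in> resolvent_set T \<and> (\<forall>x. l * norm (resolvent l T x) \<le> M * norm x))"

lemma resolvent_bounded_imp_bound:
  assumes "resolvent_bounded T"
  shows "\<exists>M. resolvent_bound M T"
proof -
  obtain M where M: "{0<..} \<subseteq> resolvent_set T"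
      "\<And>l. l > 0 \<Longrightarrow> onorm (\<lambda>x. l *\<^sub>R resolvent l T x) \<le> M"
    using assms unfolding resolvent_bounded_def by blast
  have "l * norm (resolvent l T x) \<le> M * norm x" if l: "l > 0" for l x
  proof -
    have "bounded_linear (\<lambda>x. l *\<^sub>R resolvent l T x)"
      using M(1) l by (auto simp: resolvent_set_def intro!: bounded_linear_const_scaleR)
    from onorm[OF this, of x] have "l * norm (resolvent l T x)
        \<le> onorm (\<lambda>x. l *\<^sub>R resolvent l T x) * norm x"
      using l by simp
    also have "\<dots> \<le> M * norm x"
      using M(2)[OF l] by (rule mult_right_mono) simp
    finally show ?thesis .
  qed
  with M(1) show ?thesis unfolding resolvent_bound_def by auto
qed

lemma resolvent_bound_mono:
  assumes "resolvent_bound M T" and "M \<le> N"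
  shows "resolvent_bound N T"
  using assms unfolding resolvent_bound_def
  by (meson mult_right_mono norm_ge_zero order_trans)

lemma common_resolvent_bound:
  assumes "finite F" and "\<And>T. T \<in> F \<Longrightarrow> resolvent_bounded T"
  shows "\<exists>M\<ge>1. \<forall>T\<in>F. resolvent_bound M T"
  using assms
proof (induction F rule: finite_induct)
  case (insert T F)
  then obtain M where M: "M \<ge> 1" "\<forall>T\<in>F. resolvent_bound M T" by auto
  obtain N where "resolvent_bound N T"
    using resolvent_bounded_imp_bound insert.prems by blast
  with M show ?case
    by (intro exI[of _ "max M N"]) (auto intro: resolvent_bound_mono)
qed (auto intro: exI[of _ 1])

lemma resolvent_bound_mem:
  assumes "resolvent_bound M T" and "l > 0"
  shows "l \<in> resolvent_set T"
  using assms by (simp add: resolvent_bound_def)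

lemma norm_resolvent_le:
  assumes "resolvent_bound M T" and "l > 0"
  shows "norm (resolvent l T x) \<le> M / l * norm x"
  using assms by (simp add: resolvent_bound_def field_simps)

text \<open>Under \<^term>\<open>resolvent_bound M T\<close> these operators tend strongly to the identity on the
  closure of the domain as \<open>l\<close> tends to infinity, and \<open>x \<mapsto> T (yosida l T x)\<close> is the usual Yosida
  approximation of \<open>T\<close>.\<close>

definition yosida :: "real \<Rightarrow> 'a::real_normed_vector opr \<Rightarrow> 'a \<Rightarrow> 'a" where
  "yosida l T x = l *\<^sub>R resolvent l T x"

lemma norm_yosida_le:
  assumes "resolvent_bound M T" and "l > 0"
  shows "norm (yosida l T x) \<le> M * norm x"
  using assms by (simp add: yosida_def resolvent_bound_def)

lemma linear_yosida:
  assumes "l \<in> resolvent_set T"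
  shows "linear (yosida l T)"
proof -
  have "linear (\<lambda>x. l *\<^sub>R resolvent l T x)"
    by (intro linear_compose_scale_right linear_resolvent assms)
  then show ?thesis by (simp add: yosida_def[abs_def])
qed

lemma linear_oprD:
  assumes "linear_opr T"
  shows "subspace (op_dom T)"
    and "x \<in> op_dom T \<Longrightarrow> op_app T (c *\<^sub>R x) = c *\<^sub>R op_app T x"
    and "x \<in> op_dom T \<Longrightarrow> y \<in> op_dom T \<Longrightarrow> op_app T (x - y) = op_app T x - op_app T y"
    and "op_app T 0 = 0"
proof -
  show sub: "subspace (op_dom T)"
    using assms by (simp add: linear_opr_def)
  have scale: "op_app T (c *\<^sub>R x) = c *\<^sub>R op_app T x" if "x \<in> op_dom T" for c x
    using assms that by (auto simp: linear_opr_def)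
  then show "x \<in> op_dom T \<Longrightarrow> op_app T (c *\<^sub>R x) = c *\<^sub>R op_app T x" .
  show "op_app T 0 = 0"
    using scale[OF subspace_0[OF sub], of 0] by simp
  assume xy: "x \<in> op_dom T" "y \<in> op_dom T"
  then have "op_app T (x + (-1) *\<^sub>R y) = op_app T x + op_app T ((-1) *\<^sub>R y)"
    using assms subspace_scale[OF sub] unfolding linear_opr_def by blast
  then show "op_app T (x - y) = op_app T x - op_app T y"
    using scale[OF xy(2), of "-1"] by simp
qed

lemma op_app_yosida:
  assumes "linear_opr T" and "l \<in> resolvent_set T"
  shows "yosida l T x \<in> op_dom T" and "op_app T (yosida l T x) = l *\<^sub>R (yosida l T x - x)"
  using assms resolvent_in_dom[OF assms(2), of x] op_app_resolvent[OF assms(2), of x]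
  by (auto simp: yosida_def linear_oprD subspace_scale)

lemma norm_yosida_diff_le:
  assumes "resolvent_bound M T" and "l > 0" and "M \<ge> 1"
  shows "norm (yosida l T x - x) \<le> 2 * M * norm x"
proof -
  have "norm (yosida l T x - x) \<le> M * norm x + norm x"
    using norm_triangle_ineq4[of "yosida l T x" x] norm_yosida_le[OF assms(1,2), of x] by simp
  also have "\<dots> \<le> M * norm x + M * norm x"
    using mult_right_mono[OF assms(3), of "norm x"] by simp
  finally show ?thesis by simp
qed

text \<open>Applying \<open>l - S\<close> to \<open>T z\<close> for \<open>z = R(l,S) y\<close> and moving it past \<open>T\<close> leaves
  \<open>T y - C z\<close>. The membership half of \<^const>\<open>commutator_is\<close> is what makes each product in this
  computation meaningful.\<close>

lemma commutator_is_resolvent: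
  assumes "commutator_is S T C" and "linear_opr T"
  shows "\<forall>\<^sub>F l in at_top. \<forall>y \<in> op_dom T \<inter> op_dom C.
           resolvent l S y \<in> op_dom T \<inter> op_dom C \<and>
           op_app T (resolvent l S y) = resolvent l S (op_app T y - op_app C (resolvent l S y))"
proof -
  have comm: "\<And>x. x \<in> op_dom (commutator S T) \<inter> op_dom C \<Longrightarrow>
      op_app (commutator S T) x = op_app C x"
    using assms(1) unfolding commutator_is_def by blast
  have "\<forall>\<^sub>F l in at_top. l \<in> resolvent_set S \<and>
        resolvent l S ` (op_dom T \<inter> op_dom C) \<subseteq> op_dom (commutator S T) \<inter> op_dom C"
    using assms(1) unfolding commutator_is_def by blast
  then show ?thesis
  proof eventually_elim
    case (elim l)
    show ?case
    proof
      fix y assume y: "y \<in> op_dom T \<inter> op_dom C"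
      define z where "z = resolvent l S y"
      have z: "z \<in> op_dom (commutator S T)" "z \<in> op_dom C"
        using elim y unfolding z_def by blast+
      then have dom: "z \<in> op_dom T" "op_app T z \<in> op_dom S" "z \<in> op_dom S" "op_app S z \<in> op_dom T"
        by (auto simp: commutator_def diff_opr_def comp_opr_def)
      have c: "op_app S (op_app T z) - op_app T (op_app S z) = op_app C z"
        using comm z by (auto simp: commutator_def diff_opr_def comp_opr_def)
      have "op_app T y = op_app T (l *\<^sub>R z - op_app S z)"
        using resolvent_right_inverse elim unfolding z_def by metis
      also have "\<dots> = l *\<^sub>R op_app T z - op_app T (op_app S z)"
        using dom assms(2) by (simp add: linear_oprD subspace_scale)
      finally have "op_app T y - op_app C z = l *\<^sub>R op_app T z - op_app S (op_app T z)"
        using c by (simp add: algebra_simps)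
      then have "resolvent l S (op_app T y - op_app C z) = op_app T z"
        using resolvent_left_inverse dom(2) elim by metis
      with dom z show "resolvent l S y \<in> op_dom T \<inter> op_dom C \<and>
           op_app T (resolvent l S y) = resolvent l S (op_app T y - op_app C (resolvent l S y))"
        unfolding z_def by auto
    qed
  qed
qed

lemma commutator_is_zero_yosida:
  assumes "commutator_is S T zero_opr" and "linear_opr T"
  shows "\<forall>\<^sub>F l in at_top. \<forall>y \<in> op_dom T.
           yosida l S y \<in> op_dom T \<and> op_app T (yosida l S y) = yosida l S (op_app T y)"
  using commutator_is_resolvent[OF assms]
  by eventually_elim
     (use assms(2) in \<open>auto simp: yosida_def zero_opr_def linear_oprD subspace_scale\<close>)

section \<open>K-functionals\<close>

text \<open>The part of ``continuously embedded subspace'' that K-functional estimates use. The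
  value at \<open>0\<close> must be fixed separately because a \<^typ>\<open>'a nspace\<close> carries an arbitrary function.\<close>

definition dominates_norm :: "'a::real_normed_vector nspace \<Rightarrow> bool" where
  "dominates_norm Y \<longleftrightarrow> 0 \<in> fst Y \<and> snd Y 0 = 0 \<and> (\<forall>b\<in>fst Y. norm b \<le> snd Y b)"

lemma dominates_norm_nonneg:
  assumes "dominates_norm Y" and "b \<in> fst Y"
  shows "0 \<le> snd Y b"
proof -
  have "norm b \<le> snd Y b" using assms by (simp add: dominates_norm_def)
  then show ?thesis using norm_ge_zero[of b] by linarith
qed

lemma K_functional_le:
  assumes "dominates_norm Y" and "t \<ge> 0" and "b \<in> fst Y"
  shows "K_functional whole_space Y t x \<le> norm (x - b) + t * snd Y b"
  unfolding K_functional_def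
proof (rule cInf_lower)
  show "bdd_below {snd whole_space a + t * snd Y b |a b. a \<in> fst whole_space \<and> b \<in> fst Y \<and> x = a + b}"
  proof (rule bdd_belowI[of _ 0], clarify)
    fix a b assume "b \<in> fst Y"
    then have "0 \<le> snd Y b"
      by (rule dominates_norm_nonneg[OF assms(1)])
    then show "0 \<le> snd whole_space a + t * snd Y b"
      using assms(2) by (simp add: whole_space_def)
  qed
  show "norm (x - b) + t * snd Y b \<in>
      {snd whole_space a + t * snd Y b |a b. a \<in> fst whole_space \<and> b \<in> fst Y \<and> x = a + b}"
    unfolding whole_space_def
    by (rule CollectI, rule exI[of _ "x - b"], rule exI[of _ b]) (simp add: assms(3))
qed

text \<open>Lower bounds for the infimum need it to be over a nonempty set, which the decomposition
  \<open>x = x + 0\<close> provides.\<close>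

lemma K_functional_greatest:
  assumes "dominates_norm Y" and "\<And>b. b \<in> fst Y \<Longrightarrow> c \<le> norm (x - b) + t * snd Y b"
  shows "c \<le> K_functional whole_space Y t x"
  unfolding K_functional_def
proof (rule cInf_greatest)
  have "x \<in> fst whole_space" "0 \<in> fst Y" "x = x + 0"
    using assms(1) by (auto simp: whole_space_def dominates_norm_def)
  then show "{snd whole_space a + t * snd Y b |a b.
      a \<in> fst whole_space \<and> b \<in> fst Y \<and> x = a + b} \<noteq> {}"
    by blast
next
  fix s assume "s \<in> {snd whole_space a + t * snd Y b |a b. a \<in> fst whole_space \<and> b \<in> fst Y \<and> x = a + b}"
  then obtain a b where "b \<in> fst Y" "x = a + b" "s = norm a + t * snd Y b"
    by (auto simp: whole_space_def)
  then show "c \<le> s" using assms(2)[of b] by simp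
qed

lemma K_functional_antimono_space:
  assumes "dominates_norm Y" and "dominates_norm Z" and "t \<ge> 0" and "fst Z \<subseteq> fst Y"
    and "\<And>b. b \<in> fst Z \<Longrightarrow> snd Y b \<le> snd Z b"
  shows "K_functional whole_space Y t x \<le> K_functional whole_space Z t x"
proof (rule K_functional_greatest[OF assms(2)])
  fix b assume b: "b \<in> fst Z"
  then have "K_functional whole_space Y t x \<le> norm (x - b) + t * snd Y b"
    using assms by (intro K_functional_le) auto
  also have "\<dots> \<le> norm (x - b) + t * snd Z b"
    using assms(3,5) b by (simp add: mult_left_mono)
  finally show "K_functional whole_space Y t x \<le> norm (x - b) + t * snd Z b" .
qed

lemma K_functional_mono:
  assumes "dominates_norm Y" and "0 \<le> s" and "s \<le> t"
  shows "K_functional whole_space Y s x \<le> K_functional whole_space Y t x"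
proof (rule K_functional_greatest[OF assms(1)])
  fix b assume b: "b \<in> fst Y"
  then have "0 \<le> snd Y b"
    by (rule dominates_norm_nonneg[OF assms(1)])
  then have "s * snd Y b \<le> t * snd Y b"
    using assms(3) by (rule mult_right_mono[rotated])
  then show "K_functional whole_space Y s x \<le> norm (x - b) + t * snd Y b"
    using K_functional_le[OF assms(1,2) b, of x] by simp
qed

lemma K_functional_le_norm:
  assumes "dominates_norm Y" and "t \<ge> 0"
  shows "K_functional whole_space Y t x \<le> norm x"
  using K_functional_le[OF assms, of 0 x] assms(1) by (simp add: dominates_norm_def)

text \<open>Together with the upper bound by \<open>norm x\<close> this makes the K-functional at \<open>t\<close> comparable
  with \<open>norm x\<close>, uniformly for \<open>t\<close> bounded away from \<open>0\<close>.\<close>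

lemma norm_le_K_functional:
  assumes "dominates_norm Y" and "t \<ge> 0"
  shows "min 1 t * norm x \<le> K_functional whole_space Y t x"
proof (rule K_functional_greatest[OF assms(1)])
  fix b assume b: "b \<in> fst Y"
  have "min 1 t * norm x \<le> min 1 t * (norm (x - b) + norm b)"
    using norm_triangle_ineq[of "x - b" b] assms(2) by (intro mult_left_mono) auto
  also have "\<dots> = min 1 t * norm (x - b) + min 1 t * norm b" by (simp add: distrib_left)
  also have "\<dots> \<le> 1 * norm (x - b) + t * snd Y b"
    using assms b by (intro add_mono mult_mono) (auto simp: dominates_norm_def)
  finally show "min 1 t * norm x \<le> norm (x - b) + t * snd Y b" by simp
qed

lemma K_functional_nonneg:
  assumes "dominates_norm Y" and "t \<ge> 0"
  shows "0 \<le> K_functional whole_space Y t x"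
proof -
  have "0 \<le> min 1 t * norm x" using assms(2) by simp
  then show ?thesis using norm_le_K_functional[OF assms, of x] by linarith
qed

lemma dominates_norm_domain_space:
  "linear_opr T \<Longrightarrow> dominates_norm (domain_space T)"
  by (auto simp: dominates_norm_def domain_space_def linear_oprD subspace_0)

lemma dominates_norm_family_domain_space:
  assumes "\<And>i. i \<in> {1..3} \<Longrightarrow> linear_opr (B i)"
  shows "dominates_norm (family_domain_space B)"
  using assms
  by (auto simp: dominates_norm_def family_domain_space_def linear_oprD subspace_0 sum_nonneg)

lemma dominates_norm_joint_domain_space:
  assumes "linear_opr A" and "\<And>i. i \<in> {1..3} \<Longrightarrow> linear_opr (B i)"
  shows "dominates_norm (joint_domain_space A B)"
  using assms
  by (auto simp: dominates_norm_def joint_domain_space_def linear_oprD subspace_0 sum_nonneg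
      add_nonneg_nonneg)

text \<open>For a splitting \<open>x = a + b\<close> with \<open>b\<close> in the domain, the error on \<open>a\<close> is bounded
  since the operators \<open>l R(l,T)\<close> are, and the error on \<open>b\<close> equals \<open>R(l,T) (T b)\<close>, which gains a factor
  \<open>1 / l\<close>.\<close>

lemma yosida_error_le_K:
  assumes "linear_opr T" and "resolvent_bound M T" and "M \<ge> 1" and "l > 0"
  shows "norm (yosida l T x - x) \<le> 2 * M * K_functional whole_space (domain_space T) (1 / l) x"
proof -
  have res: "l \<in> resolvent_set T" using assms(2,4) by (rule resolvent_bound_mem)
  have "norm (yosida l T x - x) / (2 * M) \<le> K_functional whole_space (domain_space T) (1 / l) x"
  proof (rule K_functional_greatest[OF dominates_norm_domain_space[OF assms(1)]])
    fix b assume "b \<in> fst (domain_space T)"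
    then have b: "b \<in> op_dom T" by (simp add: domain_space_def)
    have "b = resolvent l T (l *\<^sub>R b - op_app T b)"
      using resolvent_left_inverse[OF res b] by simp
    also have "\<dots> = yosida l T b - resolvent l T (op_app T b)"
      by (simp only: linear_diff[OF linear_resolvent[OF res]]
          linear_scale[OF linear_resolvent[OF res]] yosida_def)
    finally have Rb: "yosida l T b - b = resolvent l T (op_app T b)"
      by (simp add: algebra_simps)
    have "yosida l T x - x = (yosida l T (x - b) - (x - b)) + (yosida l T b - b)"
      by (simp add: linear_diff[OF linear_yosida[OF res]])
    then have "norm (yosida l T x - x)
        \<le> norm (yosida l T (x - b) - (x - b)) + norm (resolvent l T (op_app T b))"
      using norm_triangle_ineq Rb by metis
    also have "\<dots> \<le> 2 * M * norm (x - b) + M / l * norm (op_app T b)"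
      using assms by (intro add_mono norm_yosida_diff_le norm_resolvent_le) auto
    also have "\<dots> \<le> 2 * M * norm (x - b) + 2 * M / l * (norm b + norm (op_app T b))"
      using assms by (intro add_mono mult_mono divide_right_mono) auto
    also have "\<dots> = 2 * M * (norm (x - b) + 1 / l * snd (domain_space T) b)"
      by (simp add: domain_space_def algebra_simps add_divide_distrib)
    finally show "norm (yosida l T x - x) / (2 * M) \<le> norm (x - b) + 1 / l * snd (domain_space T) b"
      using assms(3) by (simp add: divide_le_eq mult.commute)
  qed
  then show ?thesis using assms(3) by (simp add: divide_le_eq mult.commute)
qed


section \<open>Simultaneous approximation for commuting operators\<close>

text \<open>The witness is the product of all \<open>l R(l,B\<^sub>i)\<close>, applied to \<open>x\<close>. Adding a further factor \<open>k\<close> to an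
  approximation \<open>y\<close> costs a factor \<open>M\<close> in the estimates already obtained, because the new factor
  commutes with the other \<open>B\<^sub>i\<close>. The new estimate for \<open>B\<^sub>k\<close> holds because \<open>B\<^sub>k z = l (z - y)\<close>, and
  the error of \<open>l R(l,B\<^sub>k)\<close> at \<open>y\<close> differs from that at \<open>x\<close> by at most a multiple of \<open>norm (y - x)\<close>.\<close>

lemma simultaneous_yosida_approximation:
  fixes B :: "'i \<Rightarrow> 'a::real_normed_vector opr"
  assumes "finite I" and "M \<ge> 1" and "l > 0"
    and "\<And>i. i \<in> I \<Longrightarrow> linear_opr (B i)" and "\<And>i. i \<in> I \<Longrightarrow> resolvent_bound M (B i)"
    and "\<And>i j y. i \<in> I \<Longrightarrow> j \<in> I \<Longrightarrow> y \<in> op_dom (B j) \<Longrightarrow>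
      yosida l (B i) y \<in> op_dom (B j) \<and>
      op_app (B j) (yosida l (B i) y) = yosida l (B i) (op_app (B j) y)"
  shows "\<exists>y. norm (y - x) \<le> M ^ card I * (\<Sum>i\<in>I. norm (yosida l (B i) x - x)) \<and>
    (\<forall>i\<in>I. y \<in> op_dom (B i) \<and>
      norm (op_app (B i) y) \<le> 2 * l * M ^ card I * (\<Sum>i\<in>I. norm (yosida l (B i) x - x)))"
  using assms(1,4-6)
proof (induction I rule: finite_induct)
  case (insert k I)
  define e where "e = (\<Sum>i\<in>I. norm (yosida l (B i) x - x))"
  define f where "f = norm (yosida l (B k) x - x)"
  define N where "N = M ^ card I"
  obtain y where y: "norm (y - x) \<le> N * e"
      "\<forall>i\<in>I. y \<in> op_dom (B i) \<and> norm (op_app (B i) y) \<le> 2 * l * N * e"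
    using insert unfolding e_def N_def by (metis insertCI)
  have res: "l \<in> resolvent_set (B k)" and bd: "resolvent_bound M (B k)" and lin: "linear_opr (B k)"
    using insert.prems \<open>l > 0\<close> by (auto intro: resolvent_bound_mem)
  have ef: "0 \<le> e" "0 \<le> f" "1 \<le> N" "1 \<le> M * N"
    using \<open>M \<ge> 1\<close> by (auto simp: e_def f_def N_def sum_nonneg one_le_power
        simp flip: power_Suc)
  define z where "z = yosida l (B k) y"
  have f_le: "f \<le> M * N * f"
    using mult_right_mono[OF ef(4,2)] by simp
  have "z - x = yosida l (B k) (y - x) + (yosida l (B k) x - x)"
    by (simp add: z_def linear_diff[OF linear_yosida[OF res]])
  then have "norm (z - x) \<le> norm (yosida l (B k) (y - x)) + f"
    unfolding f_def by (metis norm_triangle_ineq)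
  also have "\<dots> \<le> M * (N * e) + f"
    using norm_yosida_le[OF bd \<open>l > 0\<close>, of "y - x"] mult_left_mono[OF y(1), of M] \<open>M \<ge> 1\<close>
    by linarith
  finally have "norm (z - x) \<le> M * N * (e + f)"
    using f_le by (simp add: algebra_simps)
  moreover have "z \<in> op_dom (B i) \<and> norm (op_app (B i) z) \<le> 2 * l * (M * N) * (e + f)"
    if i: "i \<in> insert k I" for i
  proof (cases "i = k")
    case True
    have "z - y = (yosida l (B k) (y - x) - (y - x)) + (yosida l (B k) x - x)"
      by (simp add: z_def linear_diff[OF linear_yosida[OF res]])
    then have "norm (z - y) \<le> norm (yosida l (B k) (y - x) - (y - x)) + f"
      unfolding f_def by (metis norm_triangle_ineq)
    also have "\<dots> \<le> 2 * M * (N * e) + f"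
      using norm_yosida_diff_le[OF bd \<open>l > 0\<close> \<open>M \<ge> 1\<close>, of "y - x"] \<open>M \<ge> 1\<close>
        mult_left_mono[OF y(1), of "2 * M"] by linarith
    also have "\<dots> \<le> 2 * (M * N) * (e + f)"
      using f_le ef(2) by (simp add: algebra_simps)
    finally have "l * norm (z - y) \<le> l * (2 * (M * N) * (e + f))"
      using \<open>l > 0\<close> by simp
    then show ?thesis
      using op_app_yosida[OF lin res, of y] \<open>l > 0\<close> True by (simp add: z_def mult.assoc mult.left_commute)
  next
    case False
    then have iI: "i \<in> I" using i by simp
    then have "z \<in> op_dom (B i)" and Bz: "op_app (B i) z = yosida l (B k) (op_app (B i) y)"
      using insert.prems(3)[of k i y] y(2) by (auto simp: z_def)
    moreover have "norm (op_app (B i) z) \<le> M * (2 * l * N * e)"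
      using norm_yosida_le[OF bd \<open>l > 0\<close>, of "op_app (B i) y"] Bz y(2) iI \<open>M \<ge> 1\<close>
      by (smt (verit) mult_left_mono)
    moreover have "M * (2 * l * N * e) \<le> 2 * l * (M * N) * (e + f)"
      using ef \<open>l > 0\<close> \<open>M \<ge> 1\<close> by (simp add: algebra_simps)
    ultimately show ?thesis by linarith
  qed
  ultimately show ?case
    using insert.hyps unfolding e_def f_def N_def
    by (intro exI[of _ z]) (simp add: add.commute)
qed (auto intro: exI[of _ x])

section \<open>Comparing interpolation spaces\<close>

lemma powr_add_le:
  fixes a b p :: real
  assumes "0 \<le> a" and "0 \<le> b" and "0 < p"
  shows "(a + b) powr p \<le> 2 powr p * (a powr p + b powr p)"
proof -
  have "(a + b) powr p \<le> (2 * max a b) powr p"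
    using assms by (intro powr_mono2) auto
  also have "\<dots> = 2 powr p * max a b powr p"
    using assms by (simp add: powr_mult)
  also have "\<dots> \<le> 2 powr p * (a powr p + b powr p)"
    by (auto simp: max_def)
  finally show ?thesis .
qed

text \<open>The K-functional is measurable in \<open>t\<close> since it is monotone there. For negative \<open>t\<close> it is an
  infimum of a set that may be unbounded below, hence the truncation at \<open>0\<close> in the proof.\<close>

lemma measurable_interp_integrand:
  assumes "dominates_norm Y"
  shows "(\<lambda>t. ennreal ((t powr (- \<theta>) * K_functional whole_space Y t x) powr p / t)
            * indicator {0<..} t) \<in> borel_measurable borel"
proof -
  have [measurable]: "(\<lambda>t. K_functional whole_space Y (max 0 t) x) \<in> borel_measurable borel"
    by (intro borel_measurable_mono monoI K_functional_mono[OF assms]) auto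
  have "(\<lambda>t. ennreal ((t powr (- \<theta>) * K_functional whole_space Y (max 0 t) x) powr p / t)
            * indicator {0<..} t) \<in> borel_measurable borel"
    by measurable
  also have "(\<lambda>t. ennreal ((t powr (- \<theta>) * K_functional whole_space Y (max 0 t) x) powr p / t)
            * indicator {0<..} t) = (\<lambda>t. ennreal ((t powr (- \<theta>) * K_functional whole_space Y t x) powr p / t)
            * indicator {0<..} t)"
    by (auto split: split_indicator simp: max_def)
  finally show ?thesis .
qed

lemma interp_integral_mono:
  assumes "dominates_norm Y" and "0 < p"
    and "\<And>t. t > 0 \<Longrightarrow> K_functional whole_space Y t x \<le> K_functional whole_space Z t x"
  shows "interp_integral whole_space Y \<theta> p x \<le> interp_integral whole_space Z \<theta> p x"
  unfolding interp_integral_def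
  by (intro nn_integral_mono)
     (auto split: split_indicator intro!: ennreal_leI divide_right_mono powr_mono2
        mult_left_mono mult_nonneg_nonneg K_functional_nonneg less_imp_le[OF assms(2)] assms)

lemma interp_integral_le_add:
  assumes Y: "dominates_norm Y" "dominates_norm Y1" "dominates_norm Y2" and p: "0 < p" and "0 \<le> C"
    and K: "\<And>t. t > 0 \<Longrightarrow> K_functional whole_space Y t x \<le>
      C * (K_functional whole_space Y1 t x + K_functional whole_space Y2 t x)"
  shows "interp_integral whole_space Y \<theta> p x \<le> ennreal ((2 * C) powr p) *
    (interp_integral whole_space Y1 \<theta> p x + interp_integral whole_space Y2 \<theta> p x)"
proof -
  let ?g = "\<lambda>Z t. (t powr (- \<theta>) * K_functional whole_space Z t x) powr p / t"
  have bound: "?g Y t \<le> (2 * C) powr p * (?g Y1 t + ?g Y2 t)" if t: "t > 0" for t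
  proof -
    define a where "a = t powr (- \<theta>) * K_functional whole_space Y1 t x"
    define b where "b = t powr (- \<theta>) * K_functional whole_space Y2 t x"
    have ab: "0 \<le> a" "0 \<le> b"
      using t Y by (auto simp: a_def b_def intro!: mult_nonneg_nonneg K_functional_nonneg)
    have "t powr (- \<theta>) * K_functional whole_space Y t x \<le> C * (a + b)"
      using mult_left_mono[OF K[OF t], of "t powr (- \<theta>)"] by (simp add: a_def b_def algebra_simps)
    then have "(t powr (- \<theta>) * K_functional whole_space Y t x) powr p \<le> (C * (a + b)) powr p"
      using t Y p by (intro powr_mono2) (auto intro!: mult_nonneg_nonneg K_functional_nonneg)
    also have "\<dots> = C powr p * (a + b) powr p"
      using ab \<open>0 \<le> C\<close> by (simp add: powr_mult)
    also have "\<dots> \<le> C powr p * (2 powr p * (a powr p + b powr p))"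
      using ab p by (intro mult_left_mono powr_add_le) auto
    also have "\<dots> = (2 * C) powr p * (a powr p + b powr p)"
      using \<open>0 \<le> C\<close> by (simp add: powr_mult)
    finally show ?thesis
      using t by (simp add: a_def b_def field_simps)
  qed
  note meas = measurable_interp_integrand[OF Y(2)] measurable_interp_integrand[OF Y(3)]
  have "interp_integral whole_space Y \<theta> p x \<le>
      (\<integral>\<^sup>+ t. ennreal ((2 * C) powr p) *
        (ennreal (?g Y1 t) * indicator {0<..} t + ennreal (?g Y2 t) * indicator {0<..} t) \<partial>lborel)"
    unfolding interp_integral_def
  proof (rule nn_integral_mono)
    fix t :: real
    show "ennreal (?g Y t) * indicator {0<..} t \<le> ennreal ((2 * C) powr p) *
        (ennreal (?g Y1 t) * indicator {0<..} t + ennreal (?g Y2 t) * indicator {0<..} t)"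
    proof (cases "t > 0")
      case True
      then have "ennreal (?g Y t) \<le> ennreal ((2 * C) powr p * (?g Y1 t + ?g Y2 t))"
        by (intro ennreal_leI bound)
      with True show ?thesis by (simp add: ennreal_mult)
    qed simp
  qed
  also have "\<dots> = ennreal ((2 * C) powr p) *
      (interp_integral whole_space Y1 \<theta> p x + interp_integral whole_space Y2 \<theta> p x)"
    unfolding interp_integral_def
    by (subst nn_integral_cmult, simp add: borel_measurable_add meas, subst nn_integral_add)
       (simp_all add: meas)
  finally show ?thesis .
qed

text \<open>The comparison of K-functionals bounds the defining integral for \<open>Y\<close> by a multiple of the
  sum of the other two, and the embeddings bound each of these by the first. Finiteness
  of the integrals then gives equality of the sets, and \<open>p\<close>-th roots give equivalence of the norms.\<close>

lemma real_interp_eq_inter_space: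
  assumes Y: "dominates_norm Y" "dominates_norm Y1" "dominates_norm Y2" and p: "0 < p" and C: "0 < C"
    and sub: "fst Y \<subseteq> fst Y1 \<inter> fst Y2"
      "\<And>b. b \<in> fst Y \<Longrightarrow> snd Y1 b \<le> snd Y b" "\<And>b. b \<in> fst Y \<Longrightarrow> snd Y2 b \<le> snd Y b"
    and K: "\<And>t x. t > 0 \<Longrightarrow> K_functional whole_space Y t x \<le>
      C * (K_functional whole_space Y1 t x + K_functional whole_space Y2 t x)"
  shows "same_space (real_interp whole_space Y \<theta> p)
    (inter_space (real_interp whole_space Y1 \<theta> p) (real_interp whole_space Y2 \<theta> p))"
proof -
  let ?I = "\<lambda>Z x. interp_integral whole_space Z \<theta> p x"
  let ?n = "\<lambda>Z x. enn2real (?I Z x) powr (1 / p)"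
  define c where "c = (2 * C) powr p"
  define c' where "c' = c powr (1 / p) * 2 powr (1 / p)"
  have c: "c > 0" "c' > 0" using C by (auto simp: c_def c'_def)
  have mem: "x \<in> fst (real_interp whole_space Z \<theta> p) \<longleftrightarrow> ?I Z x < \<infinity>"
    if "dominates_norm Z" for Z x
  proof -
    have "x \<in> fst whole_space" "0 \<in> fst Z" "x = x + 0"
      using that by (auto simp: whole_space_def dominates_norm_def)
    then have "\<exists>a\<in>fst whole_space. \<exists>b\<in>fst Z. x = a + b" by blast
    then show ?thesis by (simp add: real_interp_def)
  qed
  have le: "?I Y1 x \<le> ?I Y x" "?I Y2 x \<le> ?I Y x" for x
    using Y p sub by (auto intro!: interp_integral_mono K_functional_antimono_space)
  have ge: "?I Y x \<le> ennreal c * (?I Y1 x + ?I Y2 x)" for x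
    unfolding c_def using Y p C K by (intro interp_integral_le_add) auto
  have fin: "?I Y x < \<infinity> \<longleftrightarrow> ?I Y1 x < \<infinity> \<and> ?I Y2 x < \<infinity>" for x
  proof
    assume "?I Y x < \<infinity>"
    then show "?I Y1 x < \<infinity> \<and> ?I Y2 x < \<infinity>" using le[of x] by (auto intro: le_less_trans)
  next
    assume "?I Y1 x < \<infinity> \<and> ?I Y2 x < \<infinity>"
    then have "ennreal c * (?I Y1 x + ?I Y2 x) < \<infinity>" by (simp add: ennreal_mult_less_top)
    then show "?I Y x < \<infinity>" using ge[of x] by (rule le_less_trans[rotated])
  qed
  have norms: "1 / c' * ?n Y x \<le> ?n Y1 x + ?n Y2 x \<and> ?n Y1 x + ?n Y2 x \<le> 2 * ?n Y x"
    if x: "?I Y x < \<infinity>" for x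
  proof
    have x12: "?I Y1 x < \<infinity>" "?I Y2 x < \<infinity>" using fin x by auto
    have "enn2real (?I Y1 x) \<le> enn2real (?I Y x)" "enn2real (?I Y2 x) \<le> enn2real (?I Y x)"
      using le[of x] x by (auto intro!: enn2real_mono)
    then have "?n Y1 x \<le> ?n Y x" "?n Y2 x \<le> ?n Y x"
      using p by (auto intro!: powr_mono2)
    then show "?n Y1 x + ?n Y2 x \<le> 2 * ?n Y x" by simp
    have "enn2real (?I Y x) \<le> enn2real (ennreal c * (?I Y1 x + ?I Y2 x))"
      using ge[of x] x12 by (intro enn2real_mono) (auto simp: ennreal_mult_less_top)
    also have "\<dots> = c * (enn2real (?I Y1 x) + enn2real (?I Y2 x))"
      using x12 c by (simp add: enn2real_mult enn2real_plus)
    finally have "?n Y x \<le> (c * (enn2real (?I Y1 x) + enn2real (?I Y2 x))) powr (1 / p)"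
      using p by (intro powr_mono2) auto
    also have "\<dots> = c powr (1 / p) * (enn2real (?I Y1 x) + enn2real (?I Y2 x)) powr (1 / p)"
      using c by (simp add: powr_mult)
    also have "\<dots> \<le> c powr (1 / p) * (2 powr (1 / p) * (?n Y1 x + ?n Y2 x))"
      using p by (intro mult_left_mono powr_add_le) auto
    finally show "1 / c' * ?n Y x \<le> ?n Y1 x + ?n Y2 x"
      using c by (simp add: c'_def field_simps)
  qed
  have sets: "fst (real_interp whole_space Y \<theta> p) =
      fst (inter_space (real_interp whole_space Y1 \<theta> p) (real_interp whole_space Y2 \<theta> p))"
    using fin Y by (auto simp: inter_space_def mem)
  have "1 / c' * snd (real_interp whole_space Y \<theta> p) x \<le> snd (inter_space
        (real_interp whole_space Y1 \<theta> p) (real_interp whole_space Y2 \<theta> p)) x \<and>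
      snd (inter_space (real_interp whole_space Y1 \<theta> p) (real_interp whole_space Y2 \<theta> p)) x
        \<le> 2 * snd (real_interp whole_space Y \<theta> p) x"
    if "x \<in> fst (real_interp whole_space Y \<theta> p)" for x
    using norms[of x] that by (simp only: mem[OF Y(1)]) (simp add: inter_space_def real_interp_def)
  moreover have "1 / c' > 0" "(2::real) > 0" using c by auto
  ultimately show ?thesis
    unfolding same_space_def using sets by blast
qed

section \<open>The commutation relations\<close>

lemma coupled_inequalities:
  fixes k p q a b :: real
  assumes "p \<le> k * (a + q)" and "q \<le> k * (b + p)" and "0 \<le> p" and "0 \<le> q" and "k \<le> 1 / 2"
  shows "p + q \<le> 2 * k * (a + b)"
proof -
  have "p + q \<le> k * (a + b) + k * (p + q)"
    using assms(1,2) by (simp add: algebra_simps)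
  moreover have "k * (p + q) \<le> 1 / 2 * (p + q)"
    using assms by (intro mult_right_mono) auto
  ultimately show ?thesis by (simp add: algebra_simps)
qed

lemma sum_1_3: "(\<Sum>i=1..3. f i) = f 1 + f 2 + f (3::nat)" for f :: "nat \<Rightarrow> real"
  by (simp add: eval_nat_numeral add.assoc)

text \<open>On \<open>z = R(l,A) y\<close> the relations \<open>[A,B\<^sub>1] = -B\<^sub>2\<close> and \<open>[A,B\<^sub>2] = -B\<^sub>1\<close> give
  \<open>B\<^sub>1 z = R(l,A) (B\<^sub>1 y + B\<^sub>2 z)\<close> and \<open>B\<^sub>2 z = R(l,A) (B\<^sub>2 y + B\<^sub>1 z)\<close>. Each right-hand side
  contains the other unknown, but with the factor \<open>M / l\<close>, so for \<open>l \<ge> 2 * M\<close> it can be absorbed.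
  Hence \<open>l R(l,A)\<close> is bounded on the joint domain of the \<open>B\<^sub>i\<close>, uniformly in large \<open>l\<close>.\<close>

lemma yosida_bounded_on_joint_domain:
  assumes A: "linear_opr A" "resolvent_bound M A" and "M \<ge> 1"
    and B: "\<And>i. i \<in> {1..3} \<Longrightarrow> linear_opr (B i)"
    and AB: "commutator_is A (B 1) (neg_opr (B 2))" "commutator_is A (B 2) (neg_opr (B 1))"
      "commutator_is A (B 3) zero_opr"
  shows "\<forall>\<^sub>F l in at_top. \<forall>y \<in> (\<Inter>i\<in>{1..3}. op_dom (B i)).
    yosida l A y \<in> (\<Inter>i\<in>{1..3}. op_dom (B i)) \<and>
    (\<Sum>i=1..3::nat. norm (op_app (B i) (yosida l A y)))
      \<le> 2 * M * (\<Sum>i=1..3. norm (op_app (B i) y))"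
proof -
  have "linear_opr (B 1)" "linear_opr (B 2)" "linear_opr (B 3)" using B by auto
  note rel = commutator_is_resolvent[OF AB(1) this(1)] commutator_is_resolvent[OF AB(2) this(2)]
    commutator_is_resolvent[OF AB(3) this(3)]
  from rel eventually_ge_at_top[of "2 * M"] show ?thesis
  proof (eventually_elim, intro ballI)
    fix l y
    assume rel: "\<forall>y\<in>op_dom (B 1) \<inter> op_dom (neg_opr (B 2)).
        resolvent l A y \<in> op_dom (B 1) \<inter> op_dom (neg_opr (B 2)) \<and>
        op_app (B 1) (resolvent l A y) =
          resolvent l A (op_app (B 1) y - op_app (neg_opr (B 2)) (resolvent l A y))"
      "\<forall>y\<in>op_dom (B 2) \<inter> op_dom (neg_opr (B 1)).
        resolvent l A y \<in> op_dom (B 2) \<inter> op_dom (neg_opr (B 1)) \<and>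
        op_app (B 2) (resolvent l A y) =
          resolvent l A (op_app (B 2) y - op_app (neg_opr (B 1)) (resolvent l A y))"
      "\<forall>y\<in>op_dom (B 3) \<inter> op_dom zero_opr.
        resolvent l A y \<in> op_dom (B 3) \<inter> op_dom zero_opr \<and>
        op_app (B 3) (resolvent l A y) =
          resolvent l A (op_app (B 3) y - op_app zero_opr (resolvent l A y))"
    assume l: "2 * M \<le> l" and y: "y \<in> (\<Inter>i\<in>{1..3}. op_dom (B i))"
    have "l > 0" using l \<open>M \<ge> 1\<close> by simp
    have y123: "y \<in> op_dom (B 1)" "y \<in> op_dom (B 2)" "y \<in> op_dom (B 3)" using y by auto
    define z where "z = resolvent l A y"
    have z: "z \<in> op_dom (B 1)" "z \<in> op_dom (B 2)" "z \<in> op_dom (B 3)"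
      and Bz: "op_app (B 1) z = resolvent l A (op_app (B 1) y + op_app (B 2) z)"
        "op_app (B 2) z = resolvent l A (op_app (B 2) y + op_app (B 1) z)"
        "op_app (B 3) z = resolvent l A (op_app (B 3) y)"
      using bspec[OF rel(1), of y] bspec[OF rel(2), of y] bspec[OF rel(3), of y] y123
      by (simp_all add: z_def neg_opr_def zero_opr_def)
    have dom: "z \<in> op_dom (B i)" if "i \<in> {1..3}" for i
    proof -
      have "i = 1 \<or> i = 2 \<or> i = 3" using that by auto
      then show ?thesis using z by auto
    qed
    have half: "M / l \<le> 1 / 2" "0 \<le> M / l" using l \<open>l > 0\<close> \<open>M \<ge> 1\<close> by (auto simp: field_simps)
    have step: "norm (resolvent l A (v + w)) \<le> M / l * (norm v + norm w)" for v w
    proof -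
      have "norm (resolvent l A (v + w)) \<le> M / l * norm (v + w)"
        using A(2) \<open>l > 0\<close> by (rule norm_resolvent_le)
      also have "\<dots> \<le> M / l * (norm v + norm w)"
        using half(2) by (intro mult_left_mono norm_triangle_ineq)
      finally show ?thesis .
    qed
    have "norm (op_app (B 1) z) \<le> M / l * (norm (op_app (B 1) y) + norm (op_app (B 2) z))"
      "norm (op_app (B 2) z) \<le> M / l * (norm (op_app (B 2) y) + norm (op_app (B 1) z))"
      using step Bz(1,2) by metis+
    then have "norm (op_app (B 1) z) + norm (op_app (B 2) z)
        \<le> 2 * (M / l) * (norm (op_app (B 1) y) + norm (op_app (B 2) y))"
      by (rule coupled_inequalities[OF _ _ norm_ge_zero norm_ge_zero half(1)])
    moreover have "norm (op_app (B 3) z) \<le> 2 * (M / l) * norm (op_app (B 3) y)"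
    proof -
      have "norm (op_app (B 3) z) \<le> M / l * norm (op_app (B 3) y)"
        unfolding Bz(3) using A(2) \<open>l > 0\<close> by (rule norm_resolvent_le)
      also have "\<dots> \<le> 2 * (M / l) * norm (op_app (B 3) y)"
        using half(2) by (intro mult_right_mono) auto
      finally show ?thesis .
    qed
    ultimately have "(\<Sum>i=1..3. norm (op_app (B i) z))
        \<le> 2 * (M / l) * (\<Sum>i=1..3. norm (op_app (B i) y))"
      unfolding sum_1_3 by (simp only: distrib_left)
    then have "l * (\<Sum>i=1..3. norm (op_app (B i) z))
        \<le> 2 * M * (\<Sum>i=1..3. norm (op_app (B i) y))"
      using \<open>l > 0\<close> by (simp add: field_simps)
    moreover have "yosida l A y \<in> op_dom (B i) \<and>
        norm (op_app (B i) (yosida l A y)) = l * norm (op_app (B i) z)" if "i \<in> {1..3}" for i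
      using B[OF that] dom[OF that] \<open>l > 0\<close>
      by (simp add: yosida_def linear_oprD subspace_scale flip: z_def)
    ultimately show "yosida l A y \<in> (\<Inter>i\<in>{1..3}. op_dom (B i)) \<and>
        (\<Sum>i=1..3. norm (op_app (B i) (yosida l A y)))
          \<le> 2 * M * (\<Sum>i=1..3. norm (op_app (B i) y))"
      by (simp add: sum_distrib_left)
  qed
qed

text \<open>The competitor in the K-functional of the joint domain at \<open>t = 1 / l\<close> is
  \<open>u = l R(l,A) y\<close>, where \<open>y\<close> approximates \<open>x\<close> simultaneously for the three \<open>B\<^sub>i\<close>. Its cost
  is bounded by multiples of the errors of \<open>l R(l,A)\<close> and \<open>l R(l,B\<^sub>i)\<close> at \<open>x\<close>, since for
  instance \<open>A u = l (u - y)\<close>; only the term \<open>norm u / l\<close> also needs \<open>norm x / l\<close>, which is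
  at most \<open>K(1 / l, x; X,D(A))\<close> as \<open>l \<ge> 1\<close>. The factor \<open>M\<^sup>5\<close> collects one \<open>M\<close> from each of the four
  resolvents in \<open>u\<close> and one from the bound of the errors by the K-functionals.\<close>

lemma joint_K_functional_le_at_resolvent_scale:
  fixes A :: "'a::real_normed_vector opr" and B :: "nat \<Rightarrow> 'a opr"
  assumes A: "linear_opr A" "resolvent_bound M A" and M: "M \<ge> 1"
    and B: "\<And>i. i \<in> {1..3} \<Longrightarrow> linear_opr (B i)"
      "\<And>i. i \<in> {1..3} \<Longrightarrow> resolvent_bound M (B i)"
    and l: "l \<ge> 1"
    and BB: "\<And>i j y. i \<in> {1..3} \<Longrightarrow> j \<in> {1..3} \<Longrightarrow> y \<in> op_dom (B j) \<Longrightarrow>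
      yosida l (B i) y \<in> op_dom (B j) \<and>
      op_app (B j) (yosida l (B i) y) = yosida l (B i) (op_app (B j) y)"
    and AB: "\<And>y. y \<in> (\<Inter>i\<in>{1..3}. op_dom (B i)) \<Longrightarrow>
      yosida l A y \<in> (\<Inter>i\<in>{1..3}. op_dom (B i)) \<and>
      (\<Sum>i=1..3. norm (op_app (B i) (yosida l A y)))
        \<le> 2 * M * (\<Sum>i=1..3. norm (op_app (B i) y))"
  shows "K_functional whole_space (joint_domain_space A B) (1 / l) x \<le>
    96 * M ^ 5 * (K_functional whole_space (domain_space A) (1 / l) x +
      K_functional whole_space (family_domain_space B) (1 / l) x)"
proof -
  define KA where "KA = K_functional whole_space (domain_space A) (1 / l) x"
  define KB where "KB = K_functional whole_space (family_domain_space B) (1 / l) x"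
  have dom: "dominates_norm (domain_space A)" "dominates_norm (family_domain_space B)"
    "dominates_norm (joint_domain_space A B)"
    by (intro dominates_norm_domain_space dominates_norm_family_domain_space
        dominates_norm_joint_domain_space A(1) B(1); assumption)+
  have l0: "l > 0" "0 \<le> 1 / l" "1 / l \<le> 1" using l by auto
  have res: "l \<in> resolvent_set A" using A(2) l0(1) by (rule resolvent_bound_mem)
  define e where "e = (\<Sum>i\<in>{1..3}. norm (yosida l (B i) x - x))"
  define E where "E = M ^ 4 * e"
  have "e \<le> (\<Sum>i\<in>{1..3::nat}. 2 * M * KB)"
    unfolding e_def
  proof (rule sum_mono)
    fix i :: nat assume i: "i \<in> {1..3}"
    have "K_functional whole_space (domain_space (B i)) (1 / l) x \<le> KB"
      unfolding KB_def
    proof (rule K_functional_antimono_space)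
      fix b
      show "snd (domain_space (B i)) b \<le> snd (family_domain_space B) b"
        using i member_le_sum[of i "{1..3}" "\<lambda>i. norm (op_app (B i) b)"]
        by (simp add: domain_space_def family_domain_space_def)
    qed (use i l0 dom(2) dominates_norm_domain_space[OF B(1)[OF i]] in
          \<open>auto simp: domain_space_def family_domain_space_def\<close>)
    then have "2 * M * K_functional whole_space (domain_space (B i)) (1 / l) x \<le> 2 * M * KB"
      using M by simp
    then show "norm (yosida l (B i) x - x) \<le> 2 * M * KB"
      using yosida_error_le_K[OF B(1)[OF i] B(2)[OF i] M l0(1), of x] by linarith
  qed
  then have e: "e \<le> 6 * M * KB" by simp
  have "E \<le> M ^ 4 * (6 * M * KB)"
    unfolding E_def using e M by (intro mult_left_mono) auto
  also have "\<dots> = 6 * M ^ 5 * KB" by (simp add: eval_nat_numeral)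
  finally have E: "E \<le> 6 * M ^ 5 * KB" .
  have "\<exists>y. norm (y - x) \<le> M ^ card {1..3::nat} * e \<and>
      (\<forall>i\<in>{1..3}. y \<in> op_dom (B i) \<and> norm (op_app (B i) y) \<le> 2 * l * M ^ card {1..3::nat} * e)"
    unfolding e_def by (rule simultaneous_yosida_approximation) (use M l0 B BB in auto)
  then obtain y where y: "norm (y - x) \<le> M ^ 3 * e" "\<And>i. i \<in> {1..3} \<Longrightarrow> y \<in> op_dom (B i)"
      "\<And>i. i \<in> {1..3} \<Longrightarrow> norm (op_app (B i) y) \<le> 2 * l * M ^ 3 * e"
    by auto
  have "M * norm (y - x) \<le> M * (M ^ 3 * e)"
    using y(1) M by (intro mult_left_mono) auto
  then have yE: "M * norm (y - x) \<le> E"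
    by (simp add: E_def eval_nat_numeral)
  define u where "u = yosida l A y"
  have uB: "\<And>i. i \<in> {1..3} \<Longrightarrow> u \<in> op_dom (B i)"
    and "(\<Sum>i=1..3. norm (op_app (B i) u)) \<le> 2 * M * (\<Sum>i=1..3. norm (op_app (B i) y))"
    using AB[of y] y(2) by (auto simp: u_def)
  moreover have "(\<Sum>i=1..3::nat. norm (op_app (B i) y)) \<le> (\<Sum>i=1..3::nat. 2 * l * M ^ 3 * e)"
    by (intro sum_mono y(3))
  then have "2 * M * (\<Sum>i=1..3. norm (op_app (B i) y)) \<le> 2 * M * (\<Sum>i=1..3::nat. 2 * l * M ^ 3 * e)"
    using M by (intro mult_left_mono) auto
  ultimately have "(\<Sum>i=1..3. norm (op_app (B i) u)) \<le> 2 * M * (6 * l * M ^ 3 * e)"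
    by (simp add: algebra_simps)
  also have "\<dots> = 12 * l * E" by (simp add: E_def eval_nat_numeral)
  finally have sumB: "1 / l * (\<Sum>i=1..3. norm (op_app (B i) u)) \<le> 12 * E"
    using l0(1) by (simp add: field_simps)
  have uA: "u \<in> op_dom A" "1 / l * norm (op_app A u) = norm (u - y)"
    using op_app_yosida[OF A(1) res, of y] l0(1) by (auto simp: u_def)
  have eA: "norm (yosida l A x - x) \<le> 2 * M * KA"
    unfolding KA_def by (rule yosida_error_le_K[OF A(1,2) M l0(1)])
  have split: "u = yosida l A (y - x) + yosida l A x"
    by (simp add: u_def linear_diff[OF linear_yosida[OF res]])
  have "u - x = yosida l A (y - x) + (yosida l A x - x)" using split by simp
  then have "norm (u - x) \<le> norm (yosida l A (y - x)) + norm (yosida l A x - x)"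
    by (metis norm_triangle_ineq)
  then have ux: "norm (x - u) \<le> E + 2 * M * KA"
    using norm_yosida_le[OF A(2) l0(1), of "y - x"] yE eA by (simp add: norm_minus_commute)
  have "u - y = (yosida l A (y - x) - (y - x)) + (yosida l A x - x)" using split by simp
  then have "norm (u - y) \<le> norm (yosida l A (y - x) - (y - x)) + norm (yosida l A x - x)"
    by (metis norm_triangle_ineq)
  then have uy: "1 / l * norm (op_app A u) \<le> 2 * E + 2 * M * KA"
    using norm_yosida_diff_le[OF A(2) l0(1) M, of "y - x"] yE eA uA(2) by linarith
  have "norm u \<le> norm (yosida l A (y - x)) + norm (yosida l A x)"
    using norm_triangle_ineq split by metis
  then have "norm u \<le> E + M * norm x"
    using norm_yosida_le[OF A(2) l0(1), of "y - x"] norm_yosida_le[OF A(2) l0(1), of x] yE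
    by linarith
  then have "1 / l * norm u \<le> 1 / l * (E + M * norm x)"
    using l0(2) by (rule mult_left_mono)
  moreover have "0 \<le> E"
    using M by (auto simp: E_def e_def sum_nonneg)
  then have "1 / l * E \<le> E" using l0(2,3) by (rule mult_left_le_one_le)
  moreover have "1 / l * norm x \<le> KA"
    unfolding KA_def using norm_le_K_functional[OF dom(1) l0(2), of x] l0(3) by simp
  then have "M * (1 / l * norm x) \<le> M * KA" using M by (intro mult_left_mono) auto
  ultimately have tu: "1 / l * norm u \<le> E + M * KA" by (simp add: algebra_simps add_divide_distrib)
  have "K_functional whole_space (joint_domain_space A B) (1 / l) x
      \<le> norm (x - u) + 1 / l * snd (joint_domain_space A B) u"
    using dom(3) l0(2) uA uB by (intro K_functional_le) (auto simp: joint_domain_space_def)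
  also have "\<dots> = norm (x - u) + 1 / l * norm u + 1 / l * norm (op_app A u)
      + 1 / l * (\<Sum>i=1..3. norm (op_app (B i) u))"
    by (simp add: joint_domain_space_def algebra_simps add_divide_distrib)
  \<comment> \<open>The multiples of \<open>E\<close> are \<open>1 + 1 + 2 + 12\<close>, the last from three terms, each with a factor
    \<open>2\<close> from the approximation \<open>y\<close> and another from the passage from \<open>y\<close> to \<open>u\<close>.\<close>
  also have "\<dots> \<le> 16 * E + 5 * (M * KA)"
    using ux tu uy sumB by linarith
  also have "\<dots> \<le> 96 * M ^ 5 * KB + 96 * M ^ 5 * KA"
  proof -
    have "0 \<le> KA" unfolding KA_def using dom(1) l0(2) by (rule K_functional_nonneg)
    moreover have "M \<le> M ^ 5" using M power_increasing[of 1 5 M] by simp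
    ultimately have "M * KA \<le> M ^ 5 * KA" "0 \<le> M * KA" using M by (auto intro: mult_right_mono)
    then show ?thesis using E by linarith
  qed
  finally show ?thesis by (simp add: KA_def KB_def algebra_simps)
qed

text \<open>The commutation relations are available only at large \<open>l\<close>, that is for small \<open>t = 1 / l\<close>.
  For the other \<open>t\<close> all the K-functionals are comparable with \<open>norm x\<close>.\<close>

lemma joint_K_functional_le:
  fixes A :: "'a::real_normed_vector opr" and B :: "nat \<Rightarrow> 'a opr"
  assumes A: "linear_opr A" "resolvent_bounded A"
    and B: "\<And>i. i \<in> {1..3} \<Longrightarrow> linear_opr (B i)"
      "\<And>i. i \<in> {1..3} \<Longrightarrow> resolvent_bounded (B i)"
    and BB: "\<And>i j. i \<in> {1..3} \<Longrightarrow> j \<in> {1..3} \<Longrightarrow> commutator_is (B i) (B j) zero_opr"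
    and AB: "commutator_is A (B 1) (neg_opr (B 2))" "commutator_is A (B 2) (neg_opr (B 1))"
      "commutator_is A (B 3) zero_opr"
  shows "\<exists>C>0. \<forall>t>0. \<forall>x. K_functional whole_space (joint_domain_space A B) t x \<le>
    C * (K_functional whole_space (domain_space A) t x +
         K_functional whole_space (family_domain_space B) t x)"
proof -
  let ?K = "K_functional whole_space (joint_domain_space A B)"
  let ?KA = "K_functional whole_space (domain_space A)"
  let ?KB = "K_functional whole_space (family_domain_space B)"
  have dom: "dominates_norm (domain_space A)" "dominates_norm (family_domain_space B)"
    "dominates_norm (joint_domain_space A B)"
    by (intro dominates_norm_domain_space dominates_norm_family_domain_space
        dominates_norm_joint_domain_space A(1) B(1); assumption)+
  have "\<exists>M\<ge>1. \<forall>T\<in>insert A (B ` {1..3}). resolvent_bound M T"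
    using A(2) B(2) by (intro common_resolvent_bound) auto
  then obtain M where M: "M \<ge> 1" "resolvent_bound M A"
      "\<And>i. i \<in> {1..3} \<Longrightarrow> resolvent_bound M (B i)" by auto
  have "\<forall>\<^sub>F l in at_top. \<forall>i\<in>{1..3}. \<forall>j\<in>{1..3}. \<forall>y \<in> op_dom (B j).
      yosida l (B i) y \<in> op_dom (B j) \<and>
      op_app (B j) (yosida l (B i) y) = yosida l (B i) (op_app (B j) y)"
    using BB B(1) by (intro eventually_ball_finite ballI commutator_is_zero_yosida) auto
  moreover have "\<forall>\<^sub>F l in at_top. \<forall>y \<in> (\<Inter>i\<in>{1..3}. op_dom (B i)).
      yosida l A y \<in> (\<Inter>i\<in>{1..3}. op_dom (B i)) \<and>
      (\<Sum>i=1..3::nat. norm (op_app (B i) (yosida l A y)))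
        \<le> 2 * M * (\<Sum>i=1..3. norm (op_app (B i) y))"
    using A(1) M(2,1) B(1) AB by (rule yosida_bounded_on_joint_domain)
  moreover have "\<forall>\<^sub>F l in at_top. (l::real) \<ge> 1"
    by (rule eventually_ge_at_top)
  ultimately
  have "\<forall>\<^sub>F l in at_top. \<forall>x. ?K (1 / l) x \<le> 96 * M ^ 5 * (?KA (1 / l) x + ?KB (1 / l) x)"
  proof eventually_elim
    case (elim l)
    then show ?case
      by (intro allI joint_K_functional_le_at_resolvent_scale A(1) M B(1)) blast+
  qed
  then obtain l0 where small: "\<And>l x. l \<ge> l0 \<Longrightarrow>
      ?K (1 / l) x \<le> 96 * M ^ 5 * (?KA (1 / l) x + ?KB (1 / l) x)"
    unfolding eventually_at_top_linorder by blast
  define t0 where "t0 = 1 / max 1 l0"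
  have t0: "t0 > 0" "t0 \<le> 1" by (auto simp: t0_def)
  have "?K t x \<le> (96 * M ^ 5 + 1 / t0) * (?KA t x + ?KB t x)" if t: "t > 0" for t x
  proof -
    have nn: "0 \<le> ?KA t x" "0 \<le> ?KB t x" "0 \<le> ?K t x"
      using dom t by (auto intro!: K_functional_nonneg)
    have "?K t x \<le> 96 * M ^ 5 * (?KA t x + ?KB t x) \<or> ?K t x \<le> 1 / t0 * (?KA t x + ?KB t x)"
    proof (cases "t \<ge> t0")
      case True
      have "t0 * ?K t x \<le> min 1 t * norm x"
        using True t t0 nn K_functional_le_norm[OF dom(3), of t x] by (intro mult_mono) auto
      also have "\<dots> \<le> ?KA t x + ?KB t x"
        using norm_le_K_functional[OF dom(1), of t x] t nn by simp
      finally show ?thesis using t0 by (simp add: field_simps)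
    next
      case False
      then have "1 / t \<ge> 1 / t0" using t by (simp add: frac_le)
      then have "1 / t \<ge> l0" by (simp add: t0_def)
      from small[OF this, of x] show ?thesis by simp
    qed
    moreover have "0 \<le> 96 * M ^ 5 * (?KA t x + ?KB t x)" "0 \<le> 1 / t0 * (?KA t x + ?KB t x)"
      using nn M(1) t0 by (auto intro!: mult_nonneg_nonneg)
    ultimately show ?thesis by (simp only: distrib_right) linarith
  qed
  moreover have "96 * M ^ 5 + 1 / t0 > 0" using M(1) t0 by (simp add: add_pos_pos)
  ultimately show ?thesis by blast
qed

theorem theorem5p2:
  fixes A :: "'a::banach opr" and B :: "nat \<Rightarrow> 'a opr" and \<theta> :: real
  assumes "closed_opr A" and "resolvent_bounded A"
    and "\<And>i. i \<in> {1..3} \<Longrightarrow> closed_opr (B i)"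
    and "\<And>i. i \<in> {1..3} \<Longrightarrow> resolvent_bounded (B i)"
    and "\<And>i j. i \<in> {1..3} \<Longrightarrow> j \<in> {1..3} \<Longrightarrow> commutator_is (B i) (B j) zero_opr"
    and "commutator_is A (B 1) (neg_opr (B 2))"
    and "commutator_is A (B 2) (neg_opr (B 1))"
    and "commutator_is A (B 3) zero_opr"
    and "0 < \<theta>" and "\<theta> < 1"
  shows "same_space
           (real_interp whole_space (joint_domain_space A B) \<theta> 2)
           (inter_space
              (real_interp whole_space (domain_space A) \<theta> 2)
              (real_interp whole_space (family_domain_space B) \<theta> 2))"
proof -
  have A: "linear_opr A" and B: "\<And>i. i \<in> {1..3} \<Longrightarrow> linear_opr (B i)"
    using assms(1,3) by (auto simp: closed_opr_def)
  obtain C where "C > 0" "\<forall>t>0. \<forall>x. K_functional whole_space (joint_domain_space A B) t x \<le>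
      C * (K_functional whole_space (domain_space A) t x +
           K_functional whole_space (family_domain_space B) t x)"
    using joint_K_functional_le[OF A assms(2) B assms(4-8)] by blast
  then show ?thesis
    using A B
    by (intro real_interp_eq_inter_space[where C = C] dominates_norm_joint_domain_space
        dominates_norm_family_domain_space dominates_norm_domain_space)
       (auto simp: joint_domain_space_def domain_space_def family_domain_space_def sum_nonneg)
qed

end
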